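(* (Asymptotic preserving property of the UGKS in the free transport regime.) Fix $\varepsilon,\Delta t,\Delta x>0$, $G\in\mathbb{R}$ and bounded measurable functions $f_i^n:[-1,1]\to\mathbb{R}$ ($i\in\mathbb{Z}$). Let $\rho_i^{n+1}$ and $f_i^{n+1}$ be given by the UGKS with coefficients $\sigma_i,\sigma_{i+1/2},\alpha_i,\alpha_{i+1/2}\ge0$. As all these coefficients tend to $0$ (with $\frac{\sigma_{i+1/2}}{\varepsilon^2}+\alpha_{i+1/2}>0$ for all $i$), for every $i$ and every $v\in[-1,1]$: (a) the microscopic flux satisfies $$\phi_{i+1/2}(v)\to\frac{v}{\varepsilon}\bigl(f_i^n\mathbf 1_{v>0}+f_{i+1}^n\mathbf 1_{v<0}\bigr)+\frac{\Delta t}{2\varepsilon}vG ;$$ (b) $f_i^{n+1}(v)$ converges to the solution (again denoted $f_i^{n+1}$) of $$\frac{f_i^{n+1}-f_i^n}{\Delta t}+\frac{1}{\Delta x}\frac{v}{\varepsilon}\Bigl((f_i^n\mathbf 1_{v>0}+f_{i+1}^n\mathbf 1_{v<0})-(f_{i-1}^n\mathbf 1_{v>0}+f_i^n\mathbf 1_{v<0})\Bigr)=G ;$$ (c) this limit scheme is a consistent approximation of the transport equation $\varepsilon\partial_tf+v\partial_xf=\varepsilon G$.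
   Context: The average of a function $\phi$ on $[-1,1]$ is $\langle\phi\rangle=\frac12\int_{-1}^1\phi(v)\,dv$; $\mathbf 1_{v>0},\mathbf 1_{v<0}$ are indicator functions of $v\in[-1,1]$. The UGKS (unified gas kinetic scheme) is a scheme for $\varepsilon\partial_tf+v\partial_xf=\frac{\sigma}{\varepsilon}(\langle f\rangle-f)-\varepsilon\alpha f+\varepsilon G$ on a uniform grid with cell centers $x_i$, interfaces $x_{i+1/2}$, space step $\Delta x$ and time step $\Delta t$. Given $f_i^n(v)$, set $\rho_i^n=\langle f_i^n\rangle$, $\rho^n_{i+1/2}=\langle f_i^n\mathbf 1_{v>0}+f_{i+1}^n\mathbf 1_{v<0}\rangle$, $\delta_x\rho^{nL}_{i+1/2}=\frac{\rho^n_{i+1/2}-\rho^n_i}{\Delta x/2}$, $\delta_x\rho^{nR}_{i+1/2}=\frac{\rho^n_{i+1}-\rho^n_{i+1/2}}{\Delta x/2}$, and $$\phi_{i+1/2}(v)=A_{i+1/2}v(f_i^n\mathbf 1_{v>0}+f_{i+1}^n\mathbf 1_{v<0})+C_{i+1/2}v\rho^n_{i+1/2}+D_{i+1/2}v^2(\delta_x\rho^{nL}_{i+1/2}\mathbf 1_{v>0}+\delta_x\rho^{nR}_{i+1/2}\mathbf 1_{v<0})+E_{i+1/2}vG,$$ where $A_{i+1/2}=A(\Delta t,\varepsilon,\sigma_{i+1/2},\alpha_{i+1/2})$ and likewise for $C,D,E$, and, with $\nu=\frac{\sigma}{\varepsilon^2}+\alpha$, $A=\frac{1}{\Delta t\varepsilon\nu}(1-e^{-\nu\Delta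 t})$, $C=\frac{\sigma}{\Delta t\varepsilon^3\nu}\bigl(\Delta t-\frac1\nu(1-e^{-\nu\Delta t})\bigr)$, $D=-\frac{\sigma}{\Delta t\varepsilon^4\nu^2}\bigl(\Delta t(1+e^{-\nu\Delta t})-\frac2\nu(1-e^{-\nu\Delta t})\bigr)$, $E=\frac{1}{\Delta t\varepsilon\nu}\bigl(\Delta t-\frac1\nu(1-e^{-\nu\Delta t})\bigr)$. With $\Phi_{i+1/2}=\langle\phi_{i+1/2}\rangle$, the scheme first computes $\rho_i^{n+1}$ from $$\frac{\rho_i^{n+1}-\rho_i^n}{\Delta t}+\frac{1}{\Delta x}(\Phi_{i+1/2}-\Phi_{i-1/2})=-\alpha_i\rho_i^{n+1}+G,$$ and then $f_i^{n+1}$ from $$\frac{f_i^{n+1}-f_i^n}{\Delta t}+\frac{1}{\Delta x}(\phi_{i+1/2}-\phi_{i-1/2})=\frac{\sigma_i}{\varepsilon^2}(\rho_i^{n+1}-f_i^{n+1})-\alpha_if_i^{n+1}+G.$$ Consistency in (c) means: for fixed $v$, if $f(t,x,v)$ is a solution of the transport equation that is smooth in $(t,x)$, then inserting $f_j^n=f(t_n,x_j,v)$ and $f_i^{n+1}=f(t_n+\Delta t,x_i,v)$ in the limit scheme, at a fixed point $(t_n,x_i)$, gives a residual that tends to $0$ as $\Delta t,\Delta x\to0$. *)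

theory Defs
  imports "HOL-Analysis.Analysis"
begin

text \<open>
  Cells \<open>x\<^sub>i\<close> are indexed by \<^typ>\<open>int\<close>; the interface \<open>x\<^sub>i\<^sub>+\<^sub>1\<^sub>/\<^sub>2\<close> carries the index \<open>i\<close>.
  Velocity functions are total on \<^typ>\<open>real\<close>, but only their values on \<open>[-1,1]\<close> matter.
\<close>

definition vavg :: "(real \<Rightarrow> real) \<Rightarrow> real" where
  "vavg g = (1/2) * integral\<^sup>L (lebesgue_on {-1..1}) g"

definition upwind :: "(int \<Rightarrow> real \<Rightarrow> real) \<Rightarrow> int \<Rightarrow> real \<Rightarrow> real" where
  "upwind f i v = f i v * indicator {0<..} v + f (i + 1) v * indicator {..<0} v"

definition rho_cell :: "(int \<Rightarrow> real \<Rightarrow> real) \<Rightarrow> int \<Rightarrow> real" where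
  "rho_cell f i = vavg (f i)"

definition rho_face :: "(int \<Rightarrow> real \<Rightarrow> real) \<Rightarrow> int \<Rightarrow> real" where
  "rho_face f i = vavg (upwind f i)"

definition slopeL :: "real \<Rightarrow> (int \<Rightarrow> real \<Rightarrow> real) \<Rightarrow> int \<Rightarrow> real" where
  "slopeL dx f i = (rho_face f i - rho_cell f i) / (dx / 2)"

definition slopeR :: "real \<Rightarrow> (int \<Rightarrow> real \<Rightarrow> real) \<Rightarrow> int \<Rightarrow> real" where
  "slopeR dx f i = (rho_cell f (i + 1) - rho_face f i) / (dx / 2)"

definition nu :: "real \<Rightarrow> real \<Rightarrow> real \<Rightarrow> real" where
  "nu eps s a = s / eps^2 + a"

definition coefA :: "real \<Rightarrow> real \<Rightarrow> real \<Rightarrow> real \<Rightarrow> real" where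
  "coefA dt eps s a = (let n = nu eps s a in
     1 / (dt * eps * n) * (1 - exp (- n * dt)))"

definition coefC :: "real \<Rightarrow> real \<Rightarrow> real \<Rightarrow> real \<Rightarrow> real" where
  "coefC dt eps s a = (let n = nu eps s a in
     s / (dt * eps^3 * n) * (dt - 1 / n * (1 - exp (- n * dt))))"

definition coefD :: "real \<Rightarrow> real \<Rightarrow> real \<Rightarrow> real \<Rightarrow> real" where
  "coefD dt eps s a = (let n = nu eps s a in
     - (s / (dt * eps^4 * n^2)) *
       (dt * (1 + exp (- n * dt)) - 2 / n * (1 - exp (- n * dt))))"

definition coefE :: "real \<Rightarrow> real \<Rightarrow> real \<Rightarrow> real \<Rightarrow> real" where
  "coefE dt eps s a = (let n = nu eps s a in
     1 / (dt * eps * n) * (dt - 1 / n * (1 - exp (- n * dt))))"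

text \<open>In \<open>micro_flux\<close> and \<open>macro_flux\<close>, \<open>s\<close> and \<open>a\<close> are the coefficients at the interfaces.\<close>

definition micro_flux ::
  "real \<Rightarrow> real \<Rightarrow> real \<Rightarrow> real \<Rightarrow> (int \<Rightarrow> real) \<Rightarrow> (int \<Rightarrow> real) \<Rightarrow>
   (int \<Rightarrow> real \<Rightarrow> real) \<Rightarrow> int \<Rightarrow> real \<Rightarrow> real" where
  "micro_flux eps dt dx G s a f i v =
     coefA dt eps (s i) (a i) * v * upwind f i v
   + coefC dt eps (s i) (a i) * v * rho_face f i
   + coefD dt eps (s i) (a i) * v^2 *
       (slopeL dx f i * indicator {0<..} v + slopeR dx f i * indicator {..<0} v)
   + coefE dt eps (s i) (a i) * v * G"

definition macro_flux ::
  "real \<Rightarrow> real \<Rightarrow> real \<Rightarrow> real \<Rightarrow> (int \<Rightarrow> real) \<Rightarrow> (int \<Rightarrow> real) \<Rightarrow>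
   (int \<Rightarrow> real \<Rightarrow> real) \<Rightarrow> int \<Rightarrow> real" where
  "macro_flux eps dt dx G s a f i = vavg (micro_flux eps dt dx G s a f i)"

text \<open>
  One implicit step \<open>f \<mapsto> (r1, f1)\<close>; \<open>sc\<close>, \<open>ac\<close> are the cell coefficients and
  \<open>sf\<close>, \<open>af\<close> the interface coefficients.
\<close>

definition ugks_step ::
  "real \<Rightarrow> real \<Rightarrow> real \<Rightarrow> real \<Rightarrow> (int \<Rightarrow> real) \<Rightarrow> (int \<Rightarrow> real) \<Rightarrow> (int \<Rightarrow> real) \<Rightarrow> (int \<Rightarrow> real) \<Rightarrow>
   (int \<Rightarrow> real \<Rightarrow> real) \<Rightarrow> (int \<Rightarrow> real) \<Rightarrow> (int \<Rightarrow> real \<Rightarrow> real) \<Rightarrow> bool" where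
  "ugks_step eps dt dx G sc ac sf af f r1 f1 \<longleftrightarrow>
     (\<forall>i. (r1 i - rho_cell f i) / dt
          + 1 / dx * (macro_flux eps dt dx G sf af f i - macro_flux eps dt dx G sf af f (i - 1))
        = - ac i * r1 i + G) \<and>
     (\<forall>i. \<forall>v\<in>{-1..1}. (f1 i v - f i v) / dt
          + 1 / dx * (micro_flux eps dt dx G sf af f i v - micro_flux eps dt dx G sf af f (i - 1) v)
        = sc i / eps^2 * (r1 i - f1 i v) - ac i * f1 i v + G)"

text \<open>Left-hand side minus right-hand side of the limit scheme, with \<open>w\<close> in place of \<open>f\<^sub>i\<^sup>n\<^sup>+\<^sup>1(v)\<close>.\<close>

definition limit_residual ::
  "real \<Rightarrow> real \<Rightarrow> real \<Rightarrow> real \<Rightarrow> (int \<Rightarrow> real \<Rightarrow> real) \<Rightarrow> int \<Rightarrow> real \<Rightarrow> real \<Rightarrow> real" where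
  "limit_residual eps dt dx G f i v w =
     (w - f i v) / dt + 1 / dx * (v / eps) * (upwind f i v - upwind f (i - 1) v) - G"

text \<open>
  \<open>Ck_on k T X g\<close>: all iterated partial derivatives of \<open>g\<close> up to order \<open>k\<close> exist and are
  continuous on \<open>T \<times> X\<close>, where \<open>T\<close> is a nondegenerate interval (time derivatives are one-sided
  at its end points) and \<open>X\<close> is open.
\<close>

primrec Ck_on :: "nat \<Rightarrow> real set \<Rightarrow> real set \<Rightarrow> (real \<Rightarrow> real \<Rightarrow> real) \<Rightarrow> bool" where
  "Ck_on 0 T X g \<longleftrightarrow> continuous_on (T \<times> X) (\<lambda>(t, x). g t x)"
| "Ck_on (Suc k) T X g \<longleftrightarrow> continuous_on (T \<times> X) (\<lambda>(t, x). g t x) \<and>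
     (\<exists>gt gx. (\<forall>t\<in>T. \<forall>x\<in>X.
          ((\<lambda>s. g s x) has_real_derivative gt t x) (at t within T) \<and>
          ((\<lambda>y. g t y) has_real_derivative gx t x) (at x)) \<and>
        Ck_on k T X gt \<and> Ck_on k T X gx)"

definition smooth_tx :: "real set \<Rightarrow> real set \<Rightarrow> (real \<Rightarrow> real \<Rightarrow> real) \<Rightarrow> bool" where
  "smooth_tx T X g \<longleftrightarrow> (\<forall>k. Ck_on k T X g)"

definition solves_transport ::
  "real \<Rightarrow> real \<Rightarrow> real set \<Rightarrow> real set \<Rightarrow> real \<Rightarrow> (real \<Rightarrow> real \<Rightarrow> real) \<Rightarrow> bool" where
  "solves_transport eps G T X v g \<longleftrightarrow>
     (\<forall>t\<in>T. \<forall>x\<in>X. \<exists>gt gx.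
        ((\<lambda>s. g s x) has_real_derivative gt) (at t within T) \<and>
        ((\<lambda>y. g t y) has_real_derivative gx) (at x) \<and>
        eps * gt + v * gx = eps * G)"

text \<open>
  Consistency at the fixed point \<open>(tn, xi)\<close>. The initial time of the solution is allowed for
  \<open>tn\<close>, so \<open>T\<close> need not be open; \<open>tn < t'\<close> makes \<open>tn + dt \<in> T\<close> for small \<open>dt\<close>.
\<close>

definition limit_scheme_consistent :: "real \<Rightarrow> real \<Rightarrow> bool" where
  "limit_scheme_consistent eps G \<longleftrightarrow>
     (\<forall>v\<in>{-1..1}. \<forall>(f :: real \<Rightarrow> real \<Rightarrow> real \<Rightarrow> real) T X tn t' xi i.
        is_interval T \<longrightarrow> tn \<in> T \<longrightarrow> t' \<in> T \<longrightarrow> tn < t' \<longrightarrow> open X \<longrightarrow> xi \<in> X \<longrightarrow>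
        smooth_tx T X (\<lambda>t x. f t x v) \<longrightarrow>
        solves_transport eps G T X v (\<lambda>t x. f t x v) \<longrightarrow>
        ((\<lambda>(dt, dx). limit_residual eps dt dx G
             (\<lambda>j. f tn (xi + of_int (j - i) * dx)) i v (f (tn + dt) xi v))
          \<longlongrightarrow> 0) (at_right 0 \<times>\<^sub>F at_right 0))"

end

theory Submission
  imports Defs "HOL-Real_Asymp.Real_Asymp"
begin

text \<open>
  With \<open>x = \<nu> \<Delta>t\<close> each UGKS coefficient is an explicit prefactor, regular at
  \<open>\<nu> = 0\<close>, times a fixed function of \<open>x\<close> alone:
  \<^item> \<open>A = 1/\<epsilon> \<cdot> (1 - exp(-x))/x\<close>,
  \<^item> \<open>E = \<Delta>t/\<epsilon> \<cdot> (x - (1 - exp(-x)))/x\<^sup>2\<close>,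
  \<^item> \<open>C = \<sigma>/\<epsilon>\<^sup>2 \<cdot> E\<close>,
  \<^item> \<open>D = - \<sigma> \<Delta>t\<^sup>2/\<epsilon>\<^sup>4 \<cdot> (x (1 + exp(-x)) - 2 (1 - exp(-x)))/x\<^sup>3\<close>,

  and the three profiles extend continuously to \<open>x = 0\<close>, with values \<open>1\<close>, \<open>1/2\<close> and \<open>1/6\<close>.
  The singularity at \<open>\<nu> = 0\<close> is therefore removable, and the surviving factor \<open>\<sigma>\<close> kills \<open>C\<close>
  and \<open>D\<close>; this gives the limit of the microscopic flux.

  Both updates are linear equations for the new value, whose leading coefficients tend to
  \<open>1/\<Delta>t\<close>. The relaxation term \<open>\<sigma>/\<epsilon>\<^sup>2 (\<rho> - f)\<close> disappears as soon as the new density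
  \<open>\<rho>\<close> stays bounded. In fact \<open>\<rho>\<close> converges, because the flux depends on the
  vanishing parameters only through the four scalars \<open>A, C, D, E\<close>, which can be pulled out of the
  velocity average (\<open>macro_flux_eq\<close>): no limit has to be interchanged with an integral, so an
  arbitrary filter may be used for the vanishing parameters. The term \<open>\<Delta>t/(2\<epsilon>) v G\<close> in the
  limiting flux is the same at all interfaces and drops out of the flux difference.

  Consistency holds because, once the sign of \<open>v\<close> is fixed, the two difference quotients of the
  limit scheme depend separately on \<open>\<Delta>t\<close> and \<open>\<Delta>x\<close>, and converge to
  \<open>\<partial>\<^sub>t f\<close> and \<open>\<partial>\<^sub>x f\<close>; so the residual tends to \<open>\<partial>\<^sub>t f + (v/\<epsilon>) \<partial>\<^sub>x f - G = 0\<close>, with no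
  condition relating \<open>\<Delta>t\<close> to \<open>\<Delta>x\<close>.
\<close>

section \<open>Free transport limit of the coefficients\<close>

lemma profiles_at_right_0:
  "((\<lambda>x::real. (1 - exp (- x)) / x) \<longlongrightarrow> 1) (at_right 0)"
  "((\<lambda>x::real. (x - (1 - exp (- x))) / x^2) \<longlongrightarrow> 1/2) (at_right 0)"
  "((\<lambda>x::real. (x * (1 + exp (- x)) - 2 * (1 - exp (- x))) / x^3) \<longlongrightarrow> 1/6) (at_right 0)"
  by real_asymp+

lemma coef_eq_profile:
  assumes "eps > 0" "dt > 0" "nu eps s a > 0"
  defines "x \<equiv> nu eps s a * dt"
  shows "coefA dt eps s a = 1 / eps * ((1 - exp (- x)) / x)"
    and "coefC dt eps s a = s / eps^2 * coefE dt eps s a"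
    and "coefD dt eps s a =
      - (s * dt^2 / eps^4) * ((x * (1 + exp (- x)) - 2 * (1 - exp (- x))) / x^3)"
    and "coefE dt eps s a = dt / eps * ((x - (1 - exp (- x))) / x^2)"
proof -
  define n where "n = nu eps s a"
  \<comment> \<open>The name hides the exponential, so that only rational identities remain.\<close>
  define e where "e = exp (- n * dt)"
  have nz: "n \<noteq> 0" "dt \<noteq> 0" "eps \<noteq> 0" and x: "x = n * dt"
    using assms(1-3) by (simp_all add: n_def x_def)
  then have ex: "exp (- x) = e"
    by (simp add: e_def)
  note coef = coefA_def coefC_def coefD_def coefE_def Let_def n_def[symmetric] e_def[symmetric]
  have "1 / (dt * eps * n) * (1 - e) = 1 / eps * ((1 - e) / (n * dt))"
    using nz by (simp add: field_simps)
  then show "coefA dt eps s a = 1 / eps * ((1 - exp (- x)) / x)"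
    by (simp only: coef ex) (simp only: x)
  have "s / (dt * eps^3 * n) * (dt - 1 / n * (1 - e)) =
      s / eps^2 * (1 / (dt * eps * n) * (dt - 1 / n * (1 - e)))"
    by (simp add: power2_eq_square power3_eq_cube)
  then show "coefC dt eps s a = s / eps^2 * coefE dt eps s a"
    by (simp only: coef)
  have "dt * (1 + e) - 2 / n * (1 - e) = (n * dt * (1 + e) - 2 * (1 - e)) / n"
    using nz by (simp add: field_simps)
  then have "- (s / (dt * eps^4 * n^2)) * (dt * (1 + e) - 2 / n * (1 - e)) =
      - (s * dt^2 / eps^4) * ((n * dt * (1 + e) - 2 * (1 - e)) / (n * dt)^3)"
    using nz by (simp add: power2_eq_square power3_eq_cube)
  then show "coefD dt eps s a =
      - (s * dt^2 / eps^4) * ((x * (1 + exp (- x)) - 2 * (1 - exp (- x))) / x^3)"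
    by (simp only: coef ex) (simp only: x)
  have "dt - 1 / n * (1 - e) = (n * dt - (1 - e)) / n"
    using nz by (simp add: field_simps)
  then have "1 / (dt * eps * n) * (dt - 1 / n * (1 - e)) =
      dt / eps * ((n * dt - (1 - e)) / (n * dt)^2)"
    using nz by (simp add: power2_eq_square)
  then show "coefE dt eps s a = dt / eps * ((x - (1 - exp (- x))) / x^2)"
    by (simp only: coef ex) (simp only: x)
qed

lemma coef_tendsto:
  fixes s a :: "'p \<Rightarrow> real"
  assumes pos: "eps > 0" "dt > 0" "\<And>p. nu eps (s p) (a p) > 0"
    and s: "(s \<longlongrightarrow> 0) F" and a: "(a \<longlongrightarrow> 0) F"
  shows "((\<lambda>p. coefA dt eps (s p) (a p)) \<longlongrightarrow> 1 / eps) F"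
    and "((\<lambda>p. coefC dt eps (s p) (a p)) \<longlongrightarrow> 0) F"
    and "((\<lambda>p. coefD dt eps (s p) (a p)) \<longlongrightarrow> 0) F"
    and "((\<lambda>p. coefE dt eps (s p) (a p)) \<longlongrightarrow> dt / (2 * eps)) F"
proof -
  define x where "x p = nu eps (s p) (a p) * dt" for p
  have "(x \<longlongrightarrow> (0 / eps^2 + 0) * dt) F"
    unfolding x_def nu_def using pos(1) by (intro tendsto_intros s a) auto
  moreover have "x p > 0" for p
    using pos by (simp add: x_def)
  ultimately have x: "filterlim x (at_right 0) F"
    by (auto simp: filterlim_at order_less_imp_not_eq2)
  note profile = profiles_at_right_0[THEN filterlim_compose, OF x]
  note eq = coef_eq_profile[OF pos, folded x_def]
  show "((\<lambda>p. coefA dt eps (s p) (a p)) \<longlongrightarrow> 1 / eps) F"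
    unfolding eq(1) using tendsto_mult_left[OF profile(1), of "1 / eps"] by simp
  show E: "((\<lambda>p. coefE dt eps (s p) (a p)) \<longlongrightarrow> dt / (2 * eps)) F"
    unfolding eq(4) using tendsto_mult_left[OF profile(2), of "dt / eps"] by (simp add: mult.commute)
  have "((\<lambda>p. s p / eps^2 * coefE dt eps (s p) (a p)) \<longlongrightarrow> 0 / eps^2 * (dt / (2 * eps))) F"
    using pos(1) by (intro tendsto_intros s E) auto
  then show "((\<lambda>p. coefC dt eps (s p) (a p)) \<longlongrightarrow> 0) F"
    unfolding eq(2) by simp
  have "((\<lambda>p. - (s p * dt^2 / eps^4)) \<longlongrightarrow> - (0 * dt^2 / eps^4)) F"
    using pos(1) by (intro tendsto_intros s) auto
  from tendsto_mult[OF this profile(3)]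
  show "((\<lambda>p. coefD dt eps (s p) (a p)) \<longlongrightarrow> 0) F"
    unfolding eq(3) by simp
qed

section \<open>Fluxes and the update\<close>

lemma micro_flux_tendsto:
  fixes s a :: "'p \<Rightarrow> int \<Rightarrow> real"
  assumes "eps > 0" "dt > 0" "\<And>p. nu eps (s p i) (a p i) > 0"
    and "((\<lambda>p. s p i) \<longlongrightarrow> 0) F" "((\<lambda>p. a p i) \<longlongrightarrow> 0) F"
  shows "((\<lambda>p. micro_flux eps dt dx G (s p) (a p) f i v) \<longlongrightarrow>
           v / eps * upwind f i v + dt / (2 * eps) * v * G) F"
proof -
  note coef = coef_tendsto[where s = "\<lambda>p. s p i" and a = "\<lambda>p. a p i", OF assms]
  have "((\<lambda>p. micro_flux eps dt dx G (s p) (a p) f i v) \<longlongrightarrow>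
      1 / eps * v * upwind f i v + 0 * v * rho_face f i
      + 0 * v^2 * (slopeL dx f i * indicator {0<..} v + slopeR dx f i * indicator {..<0} v)
      + dt / (2 * eps) * v * G) F"
    unfolding micro_flux_def by (intro tendsto_intros coef)
  then show ?thesis by simp
qed

lemma borel_imp_lebesgue_on_measurable:
  assumes "g \<in> borel_measurable borel"
  shows "g \<in> borel_measurable (lebesgue_on S)"
  using assms by (intro measurable_restrict_space1 measurable_completion) simp

lemma integrable_lebesgue_on_bounded:
  fixes g :: "real \<Rightarrow> real"
  assumes "g \<in> borel_measurable (lebesgue_on {a..b})" "\<And>v. v \<in> {a..b} \<Longrightarrow> \<bar>g v\<bar> \<le> B"
  shows "integrable (lebesgue_on {a..b}) g"
proof -
  interpret finite_measure "lebesgue_on {a..b}"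
    by (rule finite_measure_lebesgue_on) simp
  show ?thesis
    using assms by (intro integrable_const_bound[where B = B] AE_I2) auto
qed

lemma integrable_upwind_moment:
  assumes meas: "\<And>i. f i \<in> borel_measurable (lebesgue_on {-1..1})"
    and bdd: "\<And>i. bounded (f i ` {-1..1})"
  shows "integrable (lebesgue_on {-1..1}) (\<lambda>v. v * upwind f i v)"
proof -
  obtain B where B: "\<And>v. v \<in> {-1..1} \<Longrightarrow> \<bar>f i v\<bar> \<le> B"
    using bdd[of i] unfolding bounded_iff by fastforce
  obtain B' where B': "\<And>v. v \<in> {-1..1} \<Longrightarrow> \<bar>f (i + 1) v\<bar> \<le> B'"
    using bdd[of "i + 1"] unfolding bounded_iff by fastforce
  show ?thesis
  proof (rule integrable_lebesgue_on_bounded[where B = "max B B'"])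
    have [measurable]: "indicator {0<..} \<in> borel_measurable (lebesgue_on {-1..1::real})"
      "indicator {..<0} \<in> borel_measurable (lebesgue_on {-1..1::real})"
      "(\<lambda>v. v) \<in> borel_measurable (lebesgue_on {-1..1::real})"
      by (rule borel_imp_lebesgue_on_measurable; measurable)+
    note [measurable] = meas
    show "(\<lambda>v. v * upwind f i v) \<in> borel_measurable (lebesgue_on {-1..1})"
      unfolding upwind_def by measurable
    fix v :: real assume v: "v \<in> {-1..1}"
    have "\<bar>upwind f i v\<bar> \<le> max B B'"
      using B[OF v] B'[OF v] by (auto simp: upwind_def indicator_def)
    moreover have "\<bar>v\<bar> \<le> 1" using v by auto
    ultimately have "\<bar>v\<bar> * \<bar>upwind f i v\<bar> \<le> 1 * max B B'"
      by (intro mult_mono) auto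
    then show "\<bar>v * upwind f i v\<bar> \<le> max B B'" by (simp add: abs_mult)
  qed
qed

lemma vavg_add:
  assumes "integrable (lebesgue_on {-1..1}) g" "integrable (lebesgue_on {-1..1}) h"
  shows "vavg (\<lambda>v. g v + h v) = vavg g + vavg h"
  using assms by (simp add: vavg_def algebra_simps)

lemma vavg_mult: "vavg (\<lambda>v. c * g v) = c * vavg g"
  by (simp add: vavg_def)

text \<open>
  This identity turns convergence of the macroscopic flux into convergence of the four
  coefficients, without any passage to the limit under the average.
\<close>

lemma macro_flux_eq:
  assumes meas: "\<And>i. f i \<in> borel_measurable (lebesgue_on {-1..1})"
    and bdd: "\<And>i. bounded (f i ` {-1..1})"
  shows "macro_flux eps dt dx G s a f i =
      coefA dt eps (s i) (a i) * vavg (\<lambda>v. v * upwind f i v)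
    + coefC dt eps (s i) (a i) * (rho_face f i * vavg (\<lambda>v. v))
    + coefD dt eps (s i) (a i) *
        vavg (\<lambda>v. v^2 * (slopeL dx f i * indicator {0<..} v + slopeR dx f i * indicator {..<0} v))
    + coefE dt eps (s i) (a i) * (G * vavg (\<lambda>v. v))"
proof -
  define h where "h v = v^2 * (slopeL dx f i * indicator {0<..} v
    + slopeR dx f i * indicator {..<0} v)" for v :: real
  let ?L = "lebesgue_on {-1..1::real}"
  have up: "integrable ?L (\<lambda>v. v * upwind f i v)"
    using assms by (rule integrable_upwind_moment)
  have id: "integrable ?L (\<lambda>v. v)"
    by (rule integrable_lebesgue_on_bounded[where B = 1])
       (auto intro: borel_imp_lebesgue_on_measurable)
  have h: "integrable ?L h"
  proof (rule integrable_lebesgue_on_bounded[where B = "max \<bar>slopeL dx f i\<bar> \<bar>slopeR dx f i\<bar>"])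
    show "h \<in> borel_measurable ?L"
      unfolding h_def by (rule borel_imp_lebesgue_on_measurable) measurable
    fix v :: real assume "v \<in> {-1..1}"
    then have "v^2 \<le> 1" by (auto simp: abs_square_le_1 abs_le_iff)
    moreover have "\<bar>slopeL dx f i * indicator {0<..} v + slopeR dx f i * indicator {..<0} v\<bar>
        \<le> max \<bar>slopeL dx f i\<bar> \<bar>slopeR dx f i\<bar>"
      by (auto simp: indicator_def)
    ultimately have "\<bar>h v\<bar> \<le> 1 * max \<bar>slopeL dx f i\<bar> \<bar>slopeR dx f i\<bar>"
      unfolding h_def abs_mult by (intro mult_mono) auto
    then show "\<bar>h v\<bar> \<le> max \<bar>slopeL dx f i\<bar> \<bar>slopeR dx f i\<bar>" by simp
  qed
  have "micro_flux eps dt dx G s a f i = (\<lambda>v.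
      coefA dt eps (s i) (a i) * (v * upwind f i v)
    + coefC dt eps (s i) (a i) * (rho_face f i * v)
    + coefD dt eps (s i) (a i) * h v + coefE dt eps (s i) (a i) * (G * v))"
    by (simp add: fun_eq_iff micro_flux_def h_def mult_ac)
  then show ?thesis
    unfolding macro_flux_def h_def[symmetric]
    by (simp add: vavg_add vavg_mult up id h del: integral_mult_right_zero)
qed

lemma macro_flux_convergent:
  fixes s a :: "'p \<Rightarrow> int \<Rightarrow> real"
  assumes "\<And>i. f i \<in> borel_measurable (lebesgue_on {-1..1})"
    and "\<And>i. bounded (f i ` {-1..1})"
    and "eps > 0" "dt > 0" "\<And>p. nu eps (s p i) (a p i) > 0"
    and "((\<lambda>p. s p i) \<longlongrightarrow> 0) F" "((\<lambda>p. a p i) \<longlongrightarrow> 0) F"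
  shows "\<exists>L. ((\<lambda>p. macro_flux eps dt dx G (s p) (a p) f i) \<longlongrightarrow> L) F"
proof -
  note coef = coef_tendsto[where s = "\<lambda>p. s p i" and a = "\<lambda>p. a p i", OF assms(3-)]
  show ?thesis
    unfolding macro_flux_eq[OF assms(1,2)]
    by (rule exI) (rule tendsto_add[OF tendsto_add[OF tendsto_add]]
      coef[THEN tendsto_mult_right])+
qed

text \<open>
  Both lines of the scheme have this shape: an implicit Euler step with flux difference \<open>d\<close>,
  damping \<open>c\<close> and right-hand side \<open>g\<close>. Since \<open>1 + \<Delta>t c \<ge> 1\<close>, the new value is determined uniquely
  and depends continuously on these data.
\<close>

lemma implicit_step_tendsto:
  fixes u d c g :: "'p \<Rightarrow> real"
  assumes eq: "\<And>p. (u p - u0) / dt + 1 / dx * d p = - c p * u p + g p"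
    and c: "\<And>p. c p \<ge> 0" and dt: "dt > 0"
    and lim: "(d \<longlongrightarrow> d0) F" "(c \<longlongrightarrow> 0) F" "(g \<longlongrightarrow> g0) F"
  shows "(u \<longlongrightarrow> u0 + dt * (g0 - 1 / dx * d0)) F"
proof -
  have "u p = (u0 + dt * (g p - 1 / dx * d p)) / (1 + dt * c p)" for p
  proof -
    have "1 + dt * c p > 0"
      using c[of p] dt by (simp add: add_pos_nonneg)
    moreover have "u p * (1 + dt * c p) = u0 + dt * (g p - 1 / dx * d p)"
    proof -
      have "(u p - u0) / dt = - c p * u p + g p - 1 / dx * d p" using eq[of p] by linarith
      then have "u p - u0 = (- c p * u p + g p - 1 / dx * d p) * dt"
        using dt by (simp only: divide_eq_eq split: if_splits)
      then show ?thesis by (simp add: algebra_simps)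
    qed
    ultimately show ?thesis by (simp add: eq_divide_eq)
  qed
  then have "u = (\<lambda>p. (u0 + dt * (g p - 1 / dx * d p)) / (1 + dt * c p))" by auto
  moreover have "((\<lambda>p. (u0 + dt * (g p - 1 / dx * d p)) / (1 + dt * c p)) \<longlongrightarrow>
      (u0 + dt * (g0 - 1 / dx * d0)) / (1 + dt * 0)) F"
    by (intro tendsto_intros lim) simp
  ultimately show ?thesis by simp
qed

section \<open>Consistency of the limit scheme\<close>

lemma difference_quotient_at_right:
  fixes g :: "real \<Rightarrow> real"
  assumes g: "(g has_real_derivative g') (at t within T)"
    and T: "is_interval T" "t \<in> T" "t' \<in> T" "t < t'"
  shows "((\<lambda>h. (g (t + h) - g t) / h) \<longlongrightarrow> g') (at_right 0)"
proof -
  have "{t..t'} \<subseteq> T"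
    using T(1-3) mem_is_interval_1_I by (meson atLeastAtMost_iff subsetI)
  then have "(g has_real_derivative g') (at t within {t..t'})"
    by (rule DERIV_subset[OF g])
  then have "((\<lambda>y. (g y - g t) / (y - t)) \<longlongrightarrow> g') (at_right t)"
    using T(4) by (simp add: has_field_derivative_iff at_within_Icc_at_right)
  then have "((\<lambda>h. (g (h + t) - g t) / (h + t - t)) \<longlongrightarrow> g') (at_right 0)"
    by (rule filterlim_at_right_to_0[THEN iffD1])
  then show ?thesis
    by (simp only: add.commute[of _ t] add_diff_cancel_left')
qed

text \<open>
  Upwinding takes the backward difference for \<open>v > 0\<close> and the forward one for \<open>v < 0\<close>; either
  converges to the space derivative. For \<open>v = 0\<close> the transport term vanishes.
\<close>

lemma upwind_difference_tendsto:
  fixes g :: "real \<Rightarrow> real \<Rightarrow> real" and i :: int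
  assumes "((\<lambda>y. g y v) has_real_derivative g') (at x)"
  shows "((\<lambda>h. 1 / h * (v / eps) *
             (upwind (\<lambda>j. g (x + of_int (j - i) * h)) i v
              - upwind (\<lambda>j. g (x + of_int (j - i) * h)) (i - 1) v))
           \<longlongrightarrow> v / eps * g') (at_right 0)"
proof -
  have lim: "((\<lambda>h. (g (x + h) v - g x v) / h) \<longlongrightarrow> g') (at 0)"
    using assms(1) unfolding DERIV_def .
  consider "v > 0" | "v < 0" | "v = 0" by linarith
  then show ?thesis
  proof cases
    case 1
    have minus: "filterlim uminus (at 0) (at_right (0::real))"
      by (auto simp: filterlim_at eventually_at_filter intro!: tendsto_eq_intros)
    have quot: "1 / h * c * (q - p) = c * ((p - q) / - h)" for c p q h :: real
      by (simp add: divide_inverse algebra_simps)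
    have diff: "upwind (\<lambda>j. g (x + of_int (j - i) * h)) i v
        - upwind (\<lambda>j. g (x + of_int (j - i) * h)) (i - 1) v = g x v - g (x + - h) v" for h
      using 1 by (simp add: upwind_def)
    show ?thesis
      unfolding diff quot by (intro tendsto_intros filterlim_compose[OF lim minus])
  next
    case 2
    have quot: "1 / h * c * (p - q) = c * ((p - q) / h)" for c p q h :: real
      by simp
    have diff: "upwind (\<lambda>j. g (x + of_int (j - i) * h)) i v
        - upwind (\<lambda>j. g (x + of_int (j - i) * h)) (i - 1) v = g (x + h) v - g x v" for h
      using 2 by (simp add: upwind_def)
    show ?thesis
      unfolding diff quot by (intro tendsto_intros tendsto_within_subset[OF lim]) auto
  qed simp
qed

lemma limit_scheme_consistent:
  assumes "eps > 0"
  shows "limit_scheme_consistent eps G"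
  unfolding limit_scheme_consistent_def
proof (intro ballI allI impI)
  fix v and f :: "real \<Rightarrow> real \<Rightarrow> real \<Rightarrow> real" and T X tn t' xi and i :: int
  assume T: "is_interval T" "tn \<in> T" "t' \<in> T" "tn < t'" and xi: "xi \<in> X"
    and sol: "solves_transport eps G T X v (\<lambda>t x. f t x v)"
  obtain gt gx where
    gt: "((\<lambda>s. f s xi v) has_real_derivative gt) (at tn within T)" and
    gx: "((\<lambda>y. f tn y v) has_real_derivative gx) (at xi)" and
    pde: "eps * gt + v * gx = eps * G"
    using sol T(2) xi unfolding solves_transport_def by meson
  define P where "P = at_right (0::real) \<times>\<^sub>F at_right (0::real)"
  have "((\<lambda>p. (f (tn + fst p) xi v - f tn xi v) / fst p) \<longlongrightarrow> gt) P"
    using filterlim_compose[OF difference_quotient_at_right[OF gt T] filterlim_fst]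
    by (simp add: P_def)
  moreover have "((\<lambda>p. 1 / snd p * (v / eps) *
        (upwind (\<lambda>j. f tn (xi + of_int (j - i) * snd p)) i v
          - upwind (\<lambda>j. f tn (xi + of_int (j - i) * snd p)) (i - 1) v))
      \<longlongrightarrow> v / eps * gx) P"
    unfolding P_def
    by (rule filterlim_compose[OF upwind_difference_tendsto[where g = "f tn", OF gx] filterlim_snd])
  ultimately have "((\<lambda>p. (f (tn + fst p) xi v - f tn xi v) / fst p
      + 1 / snd p * (v / eps) *
        (upwind (\<lambda>j. f tn (xi + of_int (j - i) * snd p)) i v
          - upwind (\<lambda>j. f tn (xi + of_int (j - i) * snd p)) (i - 1) v) - G)
      \<longlongrightarrow> gt + v / eps * gx - G) P"
    by (intro tendsto_diff tendsto_add tendsto_const)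
  moreover have "gt + v / eps * gx - G = 0"
    using pde assms by (simp add: field_simps)
  ultimately show "((\<lambda>(dt, dx). limit_residual eps dt dx G
      (\<lambda>j. f tn (xi + of_int (j - i) * dx)) i v (f (tn + dt) xi v)) \<longlongrightarrow> 0)
      (at_right 0 \<times>\<^sub>F at_right 0)"
    unfolding limit_residual_def case_prod_unfold P_def[symmetric]
    by (simp only: diff_self of_int_0 mult_zero_left add_0_right)
qed

section \<open>The asymptotic preserving property\<close>

theorem mainTheorem4:
  fixes eps dt dx G :: real
    and f :: "int \<Rightarrow> real \<Rightarrow> real"
    and F :: "'p filter"
    and sc sf ac af :: "'p \<Rightarrow> int \<Rightarrow> real"
    and r1 :: "'p \<Rightarrow> int \<Rightarrow> real"
    and f1 :: "'p \<Rightarrow> int \<Rightarrow> real \<Rightarrow> real"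
  assumes "eps > 0" and "dt > 0" and "dx > 0"
    and "\<And>i. f i \<in> borel_measurable (lebesgue_on {-1..1})"
    and "\<And>i. bounded (f i ` {-1..1})"
    and "\<And>p i. sc p i \<ge> 0" and "\<And>p i. sf p i \<ge> 0"
    and "\<And>p i. ac p i \<ge> 0" and "\<And>p i. af p i \<ge> 0"
    and "\<And>p i. sf p i / eps^2 + af p i > 0"
    and "\<And>i. ((\<lambda>p. sc p i) \<longlongrightarrow> 0) F" and "\<And>i. ((\<lambda>p. sf p i) \<longlongrightarrow> 0) F"
    and "\<And>i. ((\<lambda>p. ac p i) \<longlongrightarrow> 0) F" and "\<And>i. ((\<lambda>p. af p i) \<longlongrightarrow> 0) F"
    and "\<And>p. ugks_step eps dt dx G (sc p) (ac p) (sf p) (af p) f (r1 p) (f1 p)"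
  shows "(\<forall>i. \<forall>v\<in>{-1..1}.
            ((\<lambda>p. micro_flux eps dt dx G (sf p) (af p) f i v) \<longlongrightarrow>
              v / eps * (f i v * indicator {0<..} v + f (i + 1) v * indicator {..<0} v)
              + dt / (2 * eps) * v * G) F)
       \<and> (\<forall>i. \<forall>v\<in>{-1..1}. \<exists>w.
            limit_residual eps dt dx G f i v w = 0 \<and>
            (\<forall>w'. limit_residual eps dt dx G f i v w' = 0 \<longrightarrow> w' = w) \<and>
            ((\<lambda>p. f1 p i v) \<longlongrightarrow> w) F)
       \<and> limit_scheme_consistent eps G"
proof -
  note eps = assms(1) and dt = assms(2)
  note meas = assms(4) and bdd = assms(5)
  have nu: "nu eps (sf p i) (af p i) > 0" for p i
    using assms(10) by (simp add: nu_def)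
  have micro: "((\<lambda>p. micro_flux eps dt dx G (sf p) (af p) f i v) \<longlongrightarrow>
      v / eps * upwind f i v + dt / (2 * eps) * v * G) F" for i v
    by (rule micro_flux_tendsto) (use eps dt nu assms(12,14) in auto)
  have "\<exists>w. limit_residual eps dt dx G f i v w = 0 \<and>
      (\<forall>w'. limit_residual eps dt dx G f i v w' = 0 \<longrightarrow> w' = w) \<and>
      ((\<lambda>p. f1 p i v) \<longlongrightarrow> w) F" if v: "v \<in> {-1..1}" for i v
  proof -
    have macro: "\<exists>L. ((\<lambda>p. macro_flux eps dt dx G (sf p) (af p) f j) \<longlongrightarrow> L) F" for j
      by (rule macro_flux_convergent[OF meas bdd eps dt nu assms(12,14)])
    obtain L L' where L: "((\<lambda>p. macro_flux eps dt dx G (sf p) (af p) f i) \<longlongrightarrow> L) F"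
        "((\<lambda>p. macro_flux eps dt dx G (sf p) (af p) f (i - 1)) \<longlongrightarrow> L') F"
      using macro[of i] macro[of "i - 1"] by blast
    have r1: "((\<lambda>p. r1 p i) \<longlongrightarrow> rho_cell f i + dt * (G - 1 / dx * (L - L'))) F"
    proof (rule implicit_step_tendsto)
      show "(r1 p i - rho_cell f i) / dt
          + 1 / dx * (macro_flux eps dt dx G (sf p) (af p) f i
              - macro_flux eps dt dx G (sf p) (af p) f (i - 1))
        = - ac p i * r1 p i + G" for p
        using assms(15)[of p] unfolding ugks_step_def by blast
    qed (use assms(8,13) dt in \<open>auto intro!: tendsto_diff L\<close>)
    define du where "du = v / eps * (upwind f i v - upwind f (i - 1) v)"
    define w where "w = f i v + dt * (G - 1 / dx * du)"
    have "((\<lambda>p. f1 p i v) \<longlongrightarrow> w) F"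
      unfolding w_def
    proof (rule implicit_step_tendsto)
      show "(f1 p i v - f i v) / dt
          + 1 / dx * (micro_flux eps dt dx G (sf p) (af p) f i v
              - micro_flux eps dt dx G (sf p) (af p) f (i - 1) v)
        = - (sc p i / eps^2 + ac p i) * f1 p i v + (sc p i / eps^2 * r1 p i + G)" for p
      proof -
        have "(f1 p i v - f i v) / dt
            + 1 / dx * (micro_flux eps dt dx G (sf p) (af p) f i v
                - micro_flux eps dt dx G (sf p) (af p) f (i - 1) v)
          = sc p i / eps^2 * (r1 p i - f1 p i v) - ac p i * f1 p i v + G"
          using assms(15)[of p] v unfolding ugks_step_def by blast
        moreover have "k * (r - u) - c * u + G = - (k + c) * u + (k * r + G)" for k r u c :: real
          by (simp add: algebra_simps)
        ultimately show ?thesis by (simp only:)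
      qed
      show "((\<lambda>p. micro_flux eps dt dx G (sf p) (af p) f i v
          - micro_flux eps dt dx G (sf p) (af p) f (i - 1) v) \<longlongrightarrow> du) F"
        using tendsto_diff[OF micro[of i v] micro[of "i - 1" v]]
        by (simp add: du_def right_diff_distrib)
      have sc: "((\<lambda>p. sc p i / eps^2) \<longlongrightarrow> 0) F"
        using tendsto_divide[OF assms(11)[of i] tendsto_const[of "eps^2"]] eps by simp
      show "((\<lambda>p. sc p i / eps^2 + ac p i) \<longlongrightarrow> 0) F"
        using tendsto_add[OF sc assms(13)[of i]] by simp
      show "((\<lambda>p. sc p i / eps^2 * r1 p i + G) \<longlongrightarrow> G) F"
        using tendsto_add[OF tendsto_mult[OF sc r1] tendsto_const[of G]] by simp
    qed (use assms(6,8) dt in auto)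
    moreover have "limit_residual eps dt dx G f i v w' = 0 \<longleftrightarrow> w' = w" for w'
    proof -
      have "limit_residual eps dt dx G f i v w' = (w' - f i v) / dt + 1 / dx * du - G"
        by (simp add: limit_residual_def du_def)
      also have "\<dots> = (w' - w) / dt"
        using dt unfolding w_def by (simp only: diff_divide_distrib add_divide_distrib) simp
      finally have "limit_residual eps dt dx G f i v w' = (w' - w) / dt" .
      then show ?thesis using dt by simp
    qed
    ultimately show ?thesis by blast
  qed
  then show ?thesis
    by (intro conjI allI ballI micro[unfolded upwind_def] limit_scheme_consistent[OF eps])
qed

end
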